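(* Let $P$ be a finite $(r,q)$-polycycle such that each of its $r$-gons (interior faces) contains an interior vertex. Then $$\frac{p_r(P)}{q}\le n_{int}(P)<\frac{r\,p_r(P)}{q}.$$
   Context: An $(r,q)$-polycycle is a simple planar 2-(vertex-)connected finite or countable graph $G$ of girth $r$ and maximal vertex-degree at most $q$ which admits an $(r,q)$-polycyclic realization on the plane. This is a plane realization in which: (1) all interior vertices have degree $q$; (2) all interior faces are combinatorial $r$-gons; (3) all vertices, edges and interior faces form a cell-complex, i.e. the intersection of any two faces is an edge, a vertex or $\emptyset$. For a finite polycycle, the interior faces are the bounded faces, and the interior vertices are those not on the boundary of the exterior (unbounded) face. An $r$-gon contains an interior vertex if at least one of its $r$ vertices is an interior vertex of the polycycle. $p_r(P)$ and $n_{int}(P)$ denote the number of interior faces and the number of interior vertices of $P$. *)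

theory Defs
  imports "HOL-Analysis.Analysis"
begin

section \<open>Finite simple graphs\<close>

text \<open>A simple graph is given by its vertex set and its edges, which are two-element sets of vertices.\<close>

definition simple_graph :: "'a set \<Rightarrow> 'a set set \<Rightarrow> bool" where
  "simple_graph V E \<longleftrightarrow> (\<forall>e\<in>E. e \<subseteq> V \<and> card e = 2)"

definition vertex_degree :: "'a set set \<Rightarrow> 'a \<Rightarrow> nat" where
  "vertex_degree E v = card {e \<in> E. v \<in> e}"

text \<open>Only edges with both ends in \<^term>\<open>V\<close> are used, so \<^term>\<open>E\<close> may be larger than the edge set
  of the graph: \<open>connected_graph (V - {v}) E\<close> speaks about the graph with \<open>v\<close> deleted.\<close>

definition connected_graph :: "'a set \<Rightarrow> 'a set set \<Rightarrow> bool" where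
  "connected_graph V E \<longleftrightarrow> V \<noteq> {} \<and>
     (\<forall>u\<in>V. \<forall>v\<in>V. (u, v) \<in> {(x, y). x \<in> V \<and> y \<in> V \<and> {x, y} \<in> E}\<^sup>*)"

definition two_connected :: "'a set \<Rightarrow> 'a set set \<Rightarrow> bool" where
  "two_connected V E \<longleftrightarrow> card V \<ge> 3 \<and> connected_graph V E \<and>
     (\<forall>v\<in>V. connected_graph (V - {v}) E)"

definition cycle_edges :: "'a list \<Rightarrow> 'a set set" where
  "cycle_edges xs = {{xs ! i, xs ! (Suc i mod length xs)} | i. i < length xs}"

definition is_cycle :: "'a set set \<Rightarrow> 'a list \<Rightarrow> bool" where
  "is_cycle E xs \<longleftrightarrow> length xs \<ge> 3 \<and> distinct xs \<and> cycle_edges xs \<subseteq> E"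

text \<open>The girth of a forest is \<open>\<infinity>\<close>.\<close>

definition girth :: "'a set set \<Rightarrow> enat" where
  "girth E = (INF xs\<in>{xs. is_cycle E xs}. enat (length xs))"


section \<open>Plane realizations and their faces\<close>

text \<open>The vertex \<open>v\<close> is drawn as the point \<open>p v\<close>, and the edge \<open>e\<close> as the arc \<open>g e\<close>; the direction
  in which \<open>g e\<close> is parametrized is irrelevant.\<close>

definition plane_realization ::
    "'a set \<Rightarrow> 'a set set \<Rightarrow> ('a \<Rightarrow> complex) \<Rightarrow> ('a set \<Rightarrow> real \<Rightarrow> complex) \<Rightarrow> bool" where
  "plane_realization V E p g \<longleftrightarrow>
     inj_on p V \<and>
     (\<forall>e\<in>E. arc (g e) \<and> {pathstart (g e), pathfinish (g e)} = p ` e \<and>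
             path_image (g e) \<inter> p ` V = p ` e) \<and>
     (\<forall>e\<in>E. \<forall>f\<in>E. e \<noteq> f \<longrightarrow> path_image (g e) \<inter> path_image (g f) = p ` (e \<inter> f))"

definition skeleton ::
    "'a set \<Rightarrow> 'a set set \<Rightarrow> ('a \<Rightarrow> complex) \<Rightarrow> ('a set \<Rightarrow> real \<Rightarrow> complex) \<Rightarrow> complex set" where
  "skeleton V E p g = p ` V \<union> (\<Union>e\<in>E. path_image (g e))"

text \<open>Faces are open sets. Those of a finite graph are the interior ones, which are bounded, and the
  exterior one, which is the only unbounded one.\<close>

definition faces ::
    "'a set \<Rightarrow> 'a set set \<Rightarrow> ('a \<Rightarrow> complex) \<Rightarrow> ('a set \<Rightarrow> real \<Rightarrow> complex) \<Rightarrow> complex set set" where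
  "faces V E p g = components (- skeleton V E p g)"

definition interior_faces ::
    "'a set \<Rightarrow> 'a set set \<Rightarrow> ('a \<Rightarrow> complex) \<Rightarrow> ('a set \<Rightarrow> real \<Rightarrow> complex) \<Rightarrow> complex set set" where
  "interior_faces V E p g = {F \<in> faces V E p g. bounded F}"

definition face_vertices :: "'a set \<Rightarrow> ('a \<Rightarrow> complex) \<Rightarrow> complex set \<Rightarrow> 'a set" where
  "face_vertices V p F = {v \<in> V. p v \<in> frontier F}"

definition interior_vertices ::
    "'a set \<Rightarrow> 'a set set \<Rightarrow> ('a \<Rightarrow> complex) \<Rightarrow> ('a set \<Rightarrow> real \<Rightarrow> complex) \<Rightarrow> 'a set" where
  "interior_vertices V E p g =
     {v \<in> V. \<forall>F \<in> faces V E p g. \<not> bounded F \<longrightarrow> v \<notin> face_vertices V p F}"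

definition combinatorial_gon ::
    "nat \<Rightarrow> 'a set set \<Rightarrow> ('a set \<Rightarrow> real \<Rightarrow> complex) \<Rightarrow> complex set \<Rightarrow> bool" where
  "combinatorial_gon r E g F \<longleftrightarrow>
     (\<exists>xs. is_cycle E xs \<and> length xs = r \<and> frontier F = (\<Union>e\<in>cycle_edges xs. path_image (g e)))"


section \<open>Finite \<open>(r,q)\<close>-polycycles\<close>

text \<open>In the last condition the cells are the closed faces; it concerns interior faces only, so an
  interior face may meet the closure of the exterior face in any way.\<close>

definition polycyclic_realization ::
    "nat \<Rightarrow> nat \<Rightarrow> 'a set \<Rightarrow> 'a set set \<Rightarrow> ('a \<Rightarrow> complex) \<Rightarrow> ('a set \<Rightarrow> real \<Rightarrow> complex) \<Rightarrow> bool" where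
  "polycyclic_realization r q V E p g \<longleftrightarrow>
     plane_realization V E p g \<and>
     (\<forall>v \<in> interior_vertices V E p g. vertex_degree E v = q) \<and>
     (\<forall>F \<in> interior_faces V E p g. combinatorial_gon r E g F) \<and>
     (\<forall>F \<in> interior_faces V E p g. \<forall>F' \<in> interior_faces V E p g. F \<noteq> F' \<longrightarrow>
        (\<exists>e\<in>E. closure F \<inter> closure F' = path_image (g e)) \<or>
        (\<exists>v\<in>V. closure F \<inter> closure F' = {p v}) \<or>
        closure F \<inter> closure F' = {})"

text \<open>Planarity is part of having a polycyclic realization.\<close>

definition finite_polycycle :: "nat \<Rightarrow> nat \<Rightarrow> 'a set \<Rightarrow> 'a set set \<Rightarrow> bool" where
  "finite_polycycle r q V E \<longleftrightarrow>
     finite V \<and> simple_graph V E \<and> two_connected V E \<and>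
     girth E = enat r \<and> (\<forall>v\<in>V. vertex_degree E v \<le> q) \<and>
     (\<exists>p g. polycyclic_realization r q V E p g)"

definition num_interior_faces ::
    "'a set \<Rightarrow> 'a set set \<Rightarrow> ('a \<Rightarrow> complex) \<Rightarrow> ('a set \<Rightarrow> real \<Rightarrow> complex) \<Rightarrow> nat" where
  "num_interior_faces V E p g = card (interior_faces V E p g)"

definition num_interior_vertices ::
    "'a set \<Rightarrow> 'a set set \<Rightarrow> ('a \<Rightarrow> complex) \<Rightarrow> ('a set \<Rightarrow> real \<Rightarrow> complex) \<Rightarrow> nat" where
  "num_interior_vertices V E p g = card (interior_vertices V E p g)"

end

theory Submission
  imports Defs
begin

text \<open>Double counting of the pairs (interior vertex, interior face containing it). Each face contributes
  between \<open>1\<close> and \<open>r\<close> pairs, so everything rests on each interior vertex lying on exactly \<open>q\<close> interior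
  faces, which follows by counting at \<open>v\<close> once every edge at an interior vertex is known to border
  exactly two interior faces.

  At least two: the skeleton is nowhere dense and there are finitely many faces, so a point of the edge
  is in the closure of a face \<open>F\<close>, and the points outside the Jordan curve \<open>frontier F\<close> accumulating there
  give another face. At most two: if \<open>F1\<close> and \<open>F2\<close> share the edge, the rest of their frontiers is
  a Jordan curve \<open>C\<close>, and Janiszewski's theorem shows that \<open>F1\<close>, \<open>F2\<close> and the edge exhaust the inside of
  \<open>C\<close>, which is a neighbourhood of the open edge.

  The upper bound is strict because otherwise the closed interior faces and the closure of the exterior
  face would be a partition of the plane into two nonempty closed sets.\<close>

subsection \<open>Edges of paths and cycles\<close>

text \<open>The recursive form suits inductions that add one edge at a time, as in
  \<open>arc_along_path\<close>; a cycle is opened into such a path and one closing edge.\<close>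

fun path_edges :: "'a list \<Rightarrow> 'a set set" where
  "path_edges (x # y # ys) = insert {x, y} (path_edges (y # ys))"
| "path_edges _ = {}"

lemma path_edges_append:
  "ys \<noteq> [] \<Longrightarrow> path_edges (ys @ [x]) = insert {last ys, x} (path_edges ys)"
  by (induction ys rule: path_edges.induct) auto

lemma path_edges_conv_nth: "path_edges xs = {{xs ! i, xs ! Suc i} | i. Suc i < length xs}"
proof (induction xs rule: path_edges.induct)
  case (1 x y ys)
  have "{{(x # y # ys) ! i, (x # y # ys) ! Suc i} | i. Suc i < length (x # y # ys)}
      = insert {x, y} {{(y # ys) ! i, (y # ys) ! Suc i} | i. Suc i < length (y # ys)}" (is "?L = ?R")
  proof
    show "?L \<subseteq> ?R"
    proof
      fix e assume "e \<in> ?L"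
      then obtain i where "e = {(x # y # ys) ! i, (x # y # ys) ! Suc i}" "Suc i < length (x # y # ys)"
        by blast
      then show "e \<in> ?R" by (cases i) auto
    qed
    show "?R \<subseteq> ?L"
      by (fastforce intro: exI[of _ 0] exI[of _ "Suc _"])
  qed
  then show ?case using 1 by simp
qed auto

lemma cycle_edges_conv_path_edges:
  assumes "xs \<noteq> []"
  shows "cycle_edges xs = insert {last xs, hd xs} (path_edges xs)"
proof -
  have "cycle_edges xs = (\<lambda>i. {xs ! i, xs ! (Suc i mod length xs)}) ` {..<length xs}"
    by (auto simp: cycle_edges_def)
  \<comment> \<open>The last index is split off because only there does the successor wrap around to
    \<open>0\<close>; it gives the closing edge.\<close>
  also have "{..<length xs} = insert (length xs - 1) {i. Suc i < length xs}"
    using assms by (auto simp: less_Suc_eq simp flip: length_greater_0_conv)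
  also have "(\<lambda>i. {xs ! i, xs ! (Suc i mod length xs)}) ` \<dots>
      = insert {last xs, hd xs} (path_edges xs)"
    using assms by (auto simp: path_edges_conv_nth last_conv_nth hd_conv_nth)
  finally show ?thesis .
qed

lemma cycle_edges_rotate: "cycle_edges (rotate n xs) = cycle_edges xs"
proof (induction n)
  case (Suc n)
  have "cycle_edges (rotate1 zs) = cycle_edges zs" for zs :: "'a list"
  proof (cases zs)
    case (Cons z ws)
    show ?thesis
    proof (cases "ws = []")
      case False
      then have "path_edges zs = insert {z, hd ws} (path_edges ws)"
        using Cons by (cases ws) auto
      then show ?thesis
        using Cons False
        by (simp add: cycle_edges_conv_path_edges path_edges_append insert_commute)
    qed (use Cons in simp)
  qed simp
  then show ?case using Suc by simp
qed simp

lemma is_cycle_rotate: "is_cycle E xs \<Longrightarrow> is_cycle E (rotate n xs)"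
  by (simp add: is_cycle_def cycle_edges_rotate)

lemma path_edges_subset_set: "e \<in> path_edges xs \<Longrightarrow> e \<subseteq> set xs"
  by (induction xs rule: path_edges.induct) auto

lemma Union_path_edges: "length xs \<ge> 2 \<Longrightarrow> \<Union> (path_edges xs) = set xs"
proof (induction xs rule: path_edges.induct)
  case (1 x y ys)
  then show ?case by (cases ys) auto
qed auto

lemma Union_cycle_edges:
  assumes "is_cycle E xs"
  shows "\<Union> (cycle_edges xs) = set xs"
proof -
  have "xs \<noteq> []" "length xs \<ge> 2" using assms by (auto simp: is_cycle_def)
  then show ?thesis by (simp add: cycle_edges_conv_path_edges Union_path_edges insert_absorb)
qed

text \<open>Rotating \<open>v\<close> to the front leaves only the first and the closing edge at
  \<open>v\<close>; they differ because a cycle has at least three distinct vertices.\<close>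

lemma card_cycle_edges_at:
  assumes "is_cycle E xs" "v \<in> set xs"
  shows "card {e \<in> cycle_edges xs. v \<in> e} = 2"
proof -
  obtain i where i: "i < length xs" "xs ! i = v"
    using assms(2) by (auto simp: in_set_conv_nth)
  define ys where "ys = rotate i xs"
  have ys: "is_cycle E ys" "cycle_edges ys = cycle_edges xs"
    using assms(1) by (simp_all add: ys_def is_cycle_rotate cycle_edges_rotate)
  have "hd ys = v"
    using i by (metis hd_rotate_conv_nth length_0_conv less_nat_zero_code mod_less ys_def)
  then obtain y z zs where yz: "ys = v # y # z # zs"
    using ys(1) by (auto simp: is_cycle_def Suc_le_length_iff numeral_3_eq_3)
  have "{e \<in> cycle_edges ys. v \<in> e} = {{v, y}, {last ys, v}}"
    using ys(1) path_edges_subset_set[of _ "y # z # zs"] yz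
    by (auto simp: cycle_edges_conv_path_edges is_cycle_def simp del: path_edges.simps(1)
      simp: path_edges.simps(1)[of v])
  moreover have "{v, y} \<noteq> {last ys, v}"
    using ys(1) yz last_in_set[of "z # zs"] by (auto simp: is_cycle_def doubleton_eq_iff)
  ultimately show ?thesis using ys(2) by simp
qed

text \<open>A rotation turns \<open>e\<close> into the closing edge, so that the other edges form a
  path joining its ends.\<close>

lemma cycle_edge_complement:
  assumes "is_cycle E xs" "e \<in> cycle_edges xs"
  obtains ys where "is_cycle E ys" "cycle_edges ys = cycle_edges xs"
    "e = {last ys, hd ys}" "e \<notin> path_edges ys"
proof -
  obtain i where i: "i < length xs" "e = {xs ! i, xs ! (Suc i mod length xs)}"
    using assms(2) by (auto simp: cycle_edges_def)
  \<comment> \<open>Rotation by \<open>i\<close> would put \<open>e\<close> first; one further step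
    makes it the edge from the last entry to the head.\<close>
  define ys where "ys = rotate (Suc i) xs"
  have ne: "xs \<noteq> []" using i by auto
  have ys: "is_cycle E ys" "cycle_edges ys = cycle_edges xs"
    using assms(1) by (simp_all add: ys_def is_cycle_rotate cycle_edges_rotate del: rotate_Suc)
  have "hd ys = xs ! (Suc i mod length xs)"
    using ne by (simp add: ys_def hd_rotate_conv_nth del: rotate_Suc)
  moreover have "last ys = xs ! i"
  proof -
    have "last ys = ys ! (length xs - 1)" using ne by (simp add: ys_def last_conv_nth del: rotate_Suc)
    also have "\<dots> = xs ! ((length xs - 1 + Suc i) mod length xs)"
      using ne by (simp add: ys_def nth_rotate add.commute del: rotate_Suc)
    also have "length xs - 1 + Suc i = length xs + i" using ne by (cases xs) auto
    finally show ?thesis using i by simp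
  qed
  ultimately have e: "e = {last ys, hd ys}" using i by simp
  moreover have "e \<notin> path_edges ys"
  proof
    assume "e \<in> path_edges ys"
    obtain a b c zs where z: "ys = a # b # c # zs"
      using ys(1) by (auto simp: is_cycle_def Suc_le_length_iff numeral_3_eq_3)
    \<comment> \<open>The end \<open>a\<close> occurs only at the head, so \<open>{a, b}\<close> is
      the one path edge containing it; the other end of \<open>e\<close> lies beyond
      \<open>b\<close>.\<close>
    have "e = {a, last (c # zs)}" using e z by auto
    moreover have "last (c # zs) \<in> set (c # zs)" by (rule last_in_set) simp
    moreover have dist: "distinct ys" using ys(1) by (simp add: is_cycle_def)
    ultimately have "e \<noteq> {a, b}" "\<not> e \<subseteq> set (b # c # zs)"
      using z by (auto simp: doubleton_eq_iff simp del: last.simps)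
    moreover have "e \<in> insert {a, b} (path_edges (b # c # zs))"
      using \<open>e \<in> path_edges ys\<close> z by simp
    ultimately show False
      using path_edges_subset_set[of e "b # c # zs"] by blast
  qed
  ultimately show thesis using that ys by blast
qed

subsection \<open>Nowhere dense arcs and theta curves\<close>

text \<open>The inverse of the parametrization would embed a nonempty open subset of the plane into
  the real line, against invariance of dimension.\<close>

lemma interior_arc_empty:
  fixes g :: "real \<Rightarrow> complex"
  assumes "arc g"
  shows "interior (path_image g) = {}"
proof -
  obtain h where h: "homeomorphism {0..1} (path_image g) g h"
    using homeomorphism_arc[OF assms] .
  then have "continuous_on (path_image g) h" "inj_on h (path_image g)"
    by (auto simp: homeomorphism_def intro: inj_on_inverseI)
  then have "continuous_on (interior (path_image g)) h" "inj_on h (interior (path_image g))"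
    using continuous_on_subset[OF _ interior_subset] inj_on_subset[OF _ interior_subset] by metis+
  then show ?thesis
    using invariance_of_dimension[of "interior (path_image g)" h] by auto
qed

lemma finite_Union_interior_empty:
  assumes "finite \<F>" "\<And>A. A \<in> \<F> \<Longrightarrow> closed A" "\<And>A. A \<in> \<F> \<Longrightarrow> interior A = {}"
  shows "interior (\<Union>\<F>) = {}"
  using assms
proof (induction rule: finite_induct)
  case (insert A \<F>)
  have "interior (\<Union>\<F>) = {}" by (rule insert.IH) (simp_all add: insert.prems)
  then have "interior (A \<union> \<Union>\<F>) = interior A"
    by (simp add: interior_closed_Un_empty_interior insert.prems)
  then show ?case by (simp add: insert.prems)
qed simp

text \<open>Here \<open>C\<close> lies between the symmetric difference and the union of
  \<open>C1\<close> and \<open>C2\<close>. A point outside both sets is joined to every far point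
  off \<open>C1\<close> and off \<open>C2\<close>; by Janiszewski's theorem it is joined to it off
  the union, hence is outside \<open>C\<close>.\<close>

lemma inside_symmetric_difference:
  fixes C C1 C2 :: "complex set"
  assumes "compact C1" "compact C2" "connected (C1 \<inter> C2)"
    and C: "C \<subseteq> C1 \<union> C2" "C1 \<union> C2 \<subseteq> C \<union> (C1 \<inter> C2)"
  shows "inside C \<subseteq> inside C1 \<union> inside C2 \<union> (C1 \<inter> C2)"
proof
  fix a assume a: "a \<in> inside C"
  show "a \<in> inside C1 \<union> inside C2 \<union> (C1 \<inter> C2)"
  proof (rule ccontr)
    assume "\<not> ?thesis"
    moreover have "a \<notin> C" using a inside_no_overlap by blast
    ultimately have out: "a \<in> outside C1" "a \<in> outside C2"
      using C inside_Un_outside[of C1] inside_Un_outside[of C2] by blast+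
    obtain B where B: "\<And>x. x \<in> C1 \<union> C2 \<Longrightarrow> norm x \<le> B"
      using assms(1,2) by (meson bounded_iff compact_Un compact_imp_bounded)
    have join: "connected_component (- D) a b" 
      if "D = C1 \<or> D = C2" "norm b > B" for D b
    proof -
      have D: "compact D" "a \<in> outside D" using that assms out by auto
      have "b \<in> outside D"
      proof (rule outside_subset_convex[THEN subsetD])
        show "convex (cball 0 B :: complex set)" "D \<subseteq> cball 0 B" "b \<in> - cball 0 B"
          using that B by auto
      qed
      moreover have "connected (outside D)" "outside D \<subseteq> - D"
        using connected_outside[OF compact_imp_bounded[OF D(1)]] outside_no_overlap[of D]
        by (simp, blast)
      ultimately show ?thesis
        unfolding connected_component_def using D by blast
    qed
    have "connected_component (- (C1 \<union> C2)) a b" if "norm b > B" for b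
      using Janiszewski[of C1 C2 a b] assms join that compact_imp_closed by blast
    then have "connected_component (- C) a b" if "norm b > B" for b
      using that C(1) by (meson Compl_anti_mono connected_component_of_subset)
    \<comment> \<open>Being in \<open>outside C\<close> means reaching points of arbitrarily large
      norm; the maximum with \<open>B\<close> puts the chosen point beyond both sets as
      well.\<close>
    moreover have "norm (complex_of_real (\<bar>max B K\<bar> + 1)) > max B K" for K
      unfolding norm_of_real by linarith
    ultimately have "a \<in> outside C"
      unfolding outside_connected_component_lt mem_Collect_eq
      by (meson max_less_iff_conj)
    then show False using a inside_Int_outside by blast
  qed
qed

text \<open>In a theta curve, \<open>C1\<close> and \<open>C2\<close> bound two cells sharing the
  middle arc, and \<open>C\<close> consists of the other two arcs. If the open middle arc were
  outside \<open>C\<close>, so would be both cells, which have it on their frontiers, and nothing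
  would be left to fill \<open>inside C\<close>.\<close>

lemma theta_middle_arc_inside:
  fixes C C1 C2 :: "complex set"
  assumes "compact C1" "compact C2" "closed C" "connected (C1 \<inter> C2)"
    and C: "C \<subseteq> C1 \<union> C2" "C1 \<union> C2 \<subseteq> C \<union> (C1 \<inter> C2)"
    and conn: "connected (C1 \<inter> C2 - C)" "C1 \<inter> C2 - C \<noteq> {}"
    and F: "connected (inside C1)" "connected (inside C2)"
      "frontier (inside C1) = C1" "frontier (inside C2) = C2" "inside C1 \<inter> inside C2 = {}"
    and "inside C \<noteq> {}"
  shows "C1 \<inter> C2 - C \<subseteq> inside C"
proof (rule ccontr)
  assume "\<not> ?thesis"
  then obtain x where x: "x \<in> C1 \<inter> C2" "x \<in> outside C"
    using inside_Un_outside[of C] by blast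
  have "x \<notin> C" using x outside_no_overlap by blast
  \<comment> \<open>The frontier of \<open>outside C\<close> is part of \<open>C\<close>, so a
    connected set avoiding \<open>C\<close> cannot leave \<open>outside C\<close>.\<close>
  have sub: "X \<subseteq> outside C" if "connected X" "X \<inter> C = {}" "X \<inter> outside C \<noteq> {}" for X
  proof -
    have "X \<inter> frontier (outside C) = {}"
      using frontier_outside_subset[OF \<open>closed C\<close>] that by blast
    then show ?thesis using connected_Int_frontier[of X "outside C"] that by blast
  qed
  have op: "open (inside C1)" "open (inside C2)" "open (outside C)"
    using assms by (auto simp: open_inside open_outside compact_imp_closed)
  have "C1 \<inter> C2 - C \<subseteq> outside C" by (rule sub) (use conn x \<open>x \<notin> C\<close> in blast)+
  \<comment> \<open>Each inside is open and misses the other, hence misses the closure of the other,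
    which contains its curve.\<close>
  moreover have meet: "inside C1 \<inter> C2 = {}" "inside C2 \<inter> C1 = {}"
    using F op open_Int_closure_eq_empty[of "inside C1" "inside C2"]
      open_Int_closure_eq_empty[of "inside C2" "inside C1"]
    by (auto simp: closure_Un_frontier)
  moreover have "inside C1 \<subseteq> outside C"
  proof (rule sub)
    show "inside C1 \<inter> C = {}" using meet C(1) inside_no_overlap by blast
    show "inside C1 \<inter> outside C \<noteq> {}"
      using op x F open_Int_closure_eq_empty[of "outside C" "inside C1"]
      by (auto simp: closure_Un_frontier)
  qed (use F in auto)
  moreover have "inside C2 \<subseteq> outside C"
  proof (rule sub)
    show "inside C2 \<inter> C = {}" using meet C(1) inside_no_overlap by blast
    show "inside C2 \<inter> outside C \<noteq> {}"
      using op x F open_Int_closure_eq_empty[of "outside C" "inside C2"]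
      by (auto simp: closure_Un_frontier)
  qed (use F in auto)
  moreover have "inside C \<subseteq> inside C1 \<union> inside C2 \<union> (C1 \<inter> C2)"
    by (rule inside_symmetric_difference) (use assms in auto)
  ultimately show False
    using \<open>inside C \<noteq> {}\<close> inside_Int_outside[of C] inside_no_overlap[of C] by blast
qed

subsection \<open>Plane graphs and their faces\<close>

locale plane_graph =
  fixes V :: "'a set" and E :: "'a set set"
    and p :: "'a \<Rightarrow> complex" and g :: "'a set \<Rightarrow> real \<Rightarrow> complex"
  assumes finite_V: "finite V" and simple: "simple_graph V E" and plane: "plane_realization V E p g"
begin

abbreviation (input) S where "S \<equiv> skeleton V E p g"

lemma edge_subset: "e \<in> E \<Longrightarrow> e \<subseteq> V"
  using simple by (simp add: simple_graph_def)

lemma finite_E: "finite E"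
  using finite_V edge_subset by (meson PowI finite_Pow_iff finite_subset subsetI)

lemma finite_edge: "e \<in> E \<Longrightarrow> finite e"
  using edge_subset finite_V finite_subset by blast

lemma arc_edge: "e \<in> E \<Longrightarrow> arc (g e)"
  using plane by (simp add: plane_realization_def)

lemma ends_edge: "e \<in> E \<Longrightarrow> {pathstart (g e), pathfinish (g e)} = p ` e"
  using plane by (simp add: plane_realization_def)

lemma edge_Int_vertices: "e \<in> E \<Longrightarrow> path_image (g e) \<inter> p ` V = p ` e"
  using plane by (simp add: plane_realization_def)

lemma edge_Int_edge: "e \<in> E \<Longrightarrow> f \<in> E \<Longrightarrow> e \<noteq> f \<Longrightarrow> path_image (g e) \<inter> path_image (g f) = p ` (e \<inter> f)"
  using plane by (simp add: plane_realization_def)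

lemma inj_p: "inj_on p V"
  using plane by (simp add: plane_realization_def)

lemma vertex_on_edge_iff: "e \<in> E \<Longrightarrow> v \<in> V \<Longrightarrow> p v \<in> path_image (g e) \<longleftrightarrow> v \<in> e"
  using edge_Int_vertices[of e] edge_subset[of e] inj_p by (auto dest: inj_onD)

lemma ends_subset: "e \<in> E \<Longrightarrow> p ` e \<subseteq> path_image (g e)"
  using edge_Int_vertices by blast

lemma endless_edge:
  assumes "e \<in> E"
  shows "connected (path_image (g e) - p ` e)" "path_image (g e) - p ` e \<noteq> {}"
  using connected_simple_path_endless[of "g e"] nonempty_simple_path_endless[of "g e"]
    arc_edge[OF assms] ends_edge[OF assms] by (auto simp: arc_imp_simple_path)

lemma closed_edge: "e \<in> E \<Longrightarrow> closed (path_image (g e))"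
  by (simp add: arc_edge closed_arc_image)

text \<open>The arc \<open>g {u, v}\<close> may run in either direction, while joining arcs needs a
  prescribed start.\<close>

lemma oriented_edge:
  assumes "{u, v} \<in> E"
  obtains c where "arc c" "pathstart c = p u" "pathfinish c = p v"
    "path_image c = path_image (g {u, v})"
proof (cases "pathstart (g {u, v}) = p u \<and> pathfinish (g {u, v}) = p v")
  case True
  then show thesis using that arc_edge[OF assms] by blast
next
  case False
  then have "pathstart (g {u, v}) = p v" "pathfinish (g {u, v}) = p u"
    using ends_edge[OF assms] by (auto simp: doubleton_eq_iff)
  then show thesis
    using that[of "reversepath (g {u, v})"] arc_edge[OF assms] by (simp add: arc_reversepath)
qed

text \<open>Induction joins the arc of the first edge to the arc of the rest. They meet only at
  \<open>p y\<close>, because by distinctness \<open>x\<close> lies on no later edge.\<close>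

lemma arc_along_path:
  assumes "distinct xs" "length xs \<ge> 2" "path_edges xs \<subseteq> E"
  shows "\<exists>c. arc c \<and> pathstart c = p (hd xs) \<and> pathfinish c = p (last xs) \<and>
    path_image c = (\<Union>e\<in>path_edges xs. path_image (g e))"
  using assms
proof (induction xs rule: path_edges.induct)
  case (1 x y ys)
  then have xy: "{x, y} \<in> E" by simp
  obtain d where d: "arc d" "pathstart d = p x" "pathfinish d = p y"
    "path_image d = path_image (g {x, y})"
    using oriented_edge[OF xy] .
  show ?case
  proof (cases "ys = []")
    case True
    then show ?thesis using d by auto
  next
    case False
    then have "length (y # ys) \<ge> 2" by (cases ys) auto
    then obtain c where c: "arc c" "pathstart c = p y" "pathfinish c = p (last (y # ys))"
      "path_image c = (\<Union>e\<in>path_edges (y # ys). path_image (g e))"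
      using 1 by auto
    have "path_image d \<inter> path_image c \<subseteq> {pathstart c}"
    proof
      fix z assume "z \<in> path_image d \<inter> path_image c"
      then obtain f where f: "f \<in> path_edges (y # ys)" "z \<in> path_image (g {x, y}) \<inter> path_image (g f)"
        using c d by auto
      moreover have "x \<notin> f" using f path_edges_subset_set 1(2) by fastforce
      moreover have "f \<in> E" using f 1 by auto
      ultimately have "z \<in> p ` ({x, y} \<inter> f)" using edge_Int_edge[OF xy, of f] by blast
      then show "z \<in> {pathstart c}" using \<open>x \<notin> f\<close> c by auto
    qed
    then have "arc (d +++ c)" using c d by (simp add: arc_join)
    moreover have "path_image (d +++ c) = (\<Union>e\<in>path_edges (x # y # ys). path_image (g e))"
      using c d by (simp add: path_image_join)
    ultimately show ?thesis using c d False by (intro exI[of _ "d +++ c"]) simp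
  qed
qed auto

text \<open>Joined with \<open>e\<close> again, this arc gives the Jordan curve of the cycle; for a
  face boundary it is what remains when a shared edge is removed.\<close>

lemma cycle_minus_edge_arc:
  assumes "is_cycle E xs" "e \<in> cycle_edges xs"
  obtains c where "arc c" "{pathstart c, pathfinish c} = p ` e"
    "path_image c = (\<Union>f\<in>cycle_edges xs - {e}. path_image (g f))"
    "path_image c \<inter> path_image (g e) = p ` e"
proof -
  obtain ys where ys: "is_cycle E ys" "cycle_edges ys = cycle_edges xs"
    "e = {last ys, hd ys}" "e \<notin> path_edges ys"
    using cycle_edge_complement[OF assms] by metis
  have "ys \<noteq> []" using ys by (auto simp: is_cycle_def)
  then have edges: "cycle_edges xs = insert e (path_edges ys)"
    using ys cycle_edges_conv_path_edges by metis
  then have "path_edges ys \<subseteq> E" "e \<in> E" using assms(1) by (auto simp: is_cycle_def)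
  then obtain c where c: "arc c" "pathstart c = p (hd ys)" "pathfinish c = p (last ys)"
    "path_image c = (\<Union>e\<in>path_edges ys. path_image (g e))"
    using arc_along_path[of ys] ys(1) by (auto simp: is_cycle_def)
  show thesis
  proof (rule that)
    show ends: "{pathstart c, pathfinish c} = p ` e" using c ys by auto
    show "path_image c = (\<Union>f\<in>cycle_edges xs - {e}. path_image (g f))"
      using c edges ys(4) by auto
    have "path_image c \<inter> path_image (g e) \<subseteq> p ` e"
      using c \<open>path_edges ys \<subseteq> E\<close> \<open>e \<in> E\<close> ys(4) edge_Int_edge[of e] by blast
    moreover have "p ` e \<subseteq> path_image c"
      unfolding ends[symmetric] by (simp add: pathstart_in_path_image pathfinish_in_path_image)
    ultimately show "path_image c \<inter> path_image (g e) = p ` e"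
      using ends_subset[OF \<open>e \<in> E\<close>] by blast
  qed (use c in auto)
qed

text \<open>Only the unordered pairs of ends are known to agree, so \<open>d\<close> is reversed
  when both arcs start at the same point.\<close>

lemma arcs_common_ends_loop:
  fixes c d :: "real \<Rightarrow> complex"
  assumes "arc c" "arc d" "{pathstart c, pathfinish c} = {pathstart d, pathfinish d}"
    "path_image c \<inter> path_image d \<subseteq> {pathstart d, pathfinish d}"
  obtains h where "simple_path h" "pathfinish h = pathstart h" "path_image h = path_image c \<union> path_image d"
proof (cases "pathstart c = pathstart d")
  case True
  then have "pathfinish c = pathfinish d" using assms(3) by (auto simp: doubleton_eq_iff)
  then show thesis
    using that[of "c +++ reversepath d"] True assms
    by (simp add: simple_path_join_loop arc_reversepath path_image_join insert_commute)
next
  case False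
  then have "pathstart c = pathfinish d" "pathfinish c = pathstart d"
    using assms(3) by (auto simp: doubleton_eq_iff)
  then show thesis
    using that[of "c +++ d"] assms
    by (simp add: simple_path_join_loop path_image_join insert_commute)
qed

lemma cycle_simple_closed_curve:
  assumes "is_cycle E xs"
  obtains h where "simple_path h" "pathfinish h = pathstart h"
    "path_image h = (\<Union>e\<in>cycle_edges xs. path_image (g e))"
proof -
  have "length xs > 0" using assms by (auto simp: is_cycle_def)
  then obtain e where e: "e \<in> cycle_edges xs" by (auto simp: cycle_edges_def)
  then have "e \<in> E" using assms by (auto simp: is_cycle_def)
  obtain c where c: "arc c" "{pathstart c, pathfinish c} = p ` e"
    "path_image c = (\<Union>f\<in>cycle_edges xs - {e}. path_image (g f))"
    "path_image c \<inter> path_image (g e) = p ` e"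
    using cycle_minus_edge_arc[OF assms e] .
  obtain h where "simple_path h" "pathfinish h = pathstart h"
      "path_image h = path_image c \<union> path_image (g e)"
    using arcs_common_ends_loop[of c "g e"] c ends_edge[OF \<open>e \<in> E\<close>] arc_edge[OF \<open>e \<in> E\<close>] by auto
  then show thesis using that[of h] c e by auto
qed

section \<open>The skeleton and its complementary faces\<close>

lemma compact_skeleton: "compact S"
  unfolding skeleton_def
  by (intro compact_Un compact_UN finite_imp_compact finite_imageI finite_V finite_E compact_arc_image
      arc_edge)

text \<open>A finite union of closed sets with empty interior has empty interior. Consequently every
  nonempty open set contains a point of some face.\<close>

lemma interior_skeleton: "interior S = {}"
proof -
  have "interior (\<Union> ((\<lambda>e. path_image (g e)) ` E)) = {}"
    by (rule finite_Union_interior_empty)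
      (use finite_E closed_edge arc_edge interior_arc_empty in auto)
  then show ?thesis
    using interior_closed_Un_empty_interior[of "p ` V" "\<Union>e\<in>E. path_image (g e)"] finite_V
    by (simp add: skeleton_def finite_imp_closed empty_interior_finite)
qed

lemma edge_subset_skeleton: "e \<in> E \<Longrightarrow> path_image (g e) \<subseteq> S"
  by (auto simp: skeleton_def)

lemma open_face: "F \<in> faces V E p g \<Longrightarrow> open F"
  using compact_skeleton open_components[of "- S" F]
  by (simp add: faces_def open_Compl compact_imp_closed)

lemma face_Int_skeleton: "F \<in> faces V E p g \<Longrightarrow> F \<inter> S = {}"
  using in_components_subset by (fastforce simp: faces_def)

lemma faces_disjoint: "F \<in> faces V E p g \<Longrightarrow> F' \<in> faces V E p g \<Longrightarrow> F \<noteq> F' \<Longrightarrow> F \<inter> F' = {}"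
  using components_nonoverlap by (fastforce simp: faces_def)

lemma outside_face: "outside S \<in> faces V E p g" "\<not> bounded (outside S)"
  using bounded_unique_outside[of S "outside S"] compact_skeleton compact_imp_bounded
  by (auto simp: faces_def)

lemma unbounded_face: "F \<in> faces V E p g \<Longrightarrow> \<not> bounded F \<Longrightarrow> F = outside S"
  using bounded_unique_outside[of S F] compact_skeleton compact_imp_bounded
  by (auto simp: faces_def)

lemma interior_faceD: "F \<in> interior_faces V E p g \<Longrightarrow> F \<in> faces V E p g"
  by (simp add: interior_faces_def)

lemma interior_face_Int_outside:
  assumes "F \<in> interior_faces V E p g"
  shows "F \<inter> outside S = {}"
proof (rule faces_disjoint)
  show "F \<noteq> outside S" using assms outside_face(2) by (auto simp: interior_faces_def)
qed (use assms interior_faceD outside_face(1) in auto)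

lemma Union_interior_faces: "\<Union> (interior_faces V E p g) = inside S"
proof -
  have "\<Union> (interior_faces V E p g) \<union> outside S = - S"
  proof -
    have "- S = \<Union> (faces V E p g)" by (simp add: faces_def flip: Union_components)
    also have "faces V E p g = insert (outside S) (interior_faces V E p g)"
      using unbounded_face outside_face(1) unfolding interior_faces_def by blast
    finally show ?thesis by auto
  qed
  then show ?thesis
    using interior_face_Int_outside inside_Un_outside[of S] inside_Int_outside[of S] by blast
qed

text \<open>A drawn vertex lies on the skeleton, so for it frontier and closure of the exterior face
  agree. The closure is preferred because its complement is an open neighbourhood of
  \<open>p v\<close>.\<close>

lemma interior_vertex_iff: "v \<in> interior_vertices V E p g \<longleftrightarrow> v \<in> V \<and> p v \<notin> closure (outside S)"
proof -
  have "v \<in> interior_vertices V E p g \<longleftrightarrow> v \<in> V \<and> p v \<notin> frontier (outside S)"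
    unfolding interior_vertices_def face_vertices_def mem_Collect_eq
    using outside_face unbounded_face by metis
  moreover have "p v \<notin> outside S" if "v \<in> V"
  proof -
    have "p v \<in> S" using that by (simp add: skeleton_def)
    then show ?thesis using outside_no_overlap[of S] by blast
  qed
  ultimately show ?thesis
    using interior_subset[of "outside S"] by (auto simp: frontier_def)
qed

text \<open>A connected set that meets \<open>F\<close> but not \<open>frontier F\<close> lies in
  \<open>F\<close>. Applied to the outside of the curve, this contradicts boundedness of
  \<open>F\<close> unless \<open>F\<close> is inside; applied to the inside, it gives the reverse
  inclusion.\<close>

lemma face_eq_inside:
  assumes "F \<in> interior_faces V E p g" "frontier F = path_image h"
    "simple_path h" "pathfinish h = pathstart h"
  shows "F = inside (path_image h)"
proof (rule equalityI)
  have F: "F \<noteq> {}" "open F" "bounded F" "connected F"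
    using assms(1) open_face in_components_nonempty in_components_connected
    by (auto simp: interior_faces_def faces_def)
  have disj: "F \<inter> path_image h = {}"
    using assms(2) F(2) by (auto simp: frontier_def interior_open)
  have J: "connected (inside (path_image h))" "outside (path_image h) \<inter> path_image h = {}"
    "frontier (outside (path_image h)) = path_image h" "\<not> bounded (outside (path_image h))"
    "connected (outside (path_image h))"
    using Jordan_inside_outside[OF assms(3,4)] by auto
  show sub: "F \<subseteq> inside (path_image h)"
  proof (rule ccontr)
    assume "\<not> ?thesis"
    then have "outside (path_image h) \<inter> F \<noteq> {}" using disj inside_Un_outside by blast
    moreover have "\<not> outside (path_image h) \<subseteq> F" using J F(3) bounded_subset by blast
    ultimately show False
      using connected_Int_frontier[of "outside (path_image h)" F] J assms(2) by blast
  qed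
  show "inside (path_image h) \<subseteq> F"
    using connected_Int_frontier[of "inside (path_image h)" F] J sub F(1) assms(2)
      inside_no_overlap[of "path_image h"] by blast
qed

end

subsection \<open>Polycyclic realizations\<close>

locale polycyclic = plane_graph +
  fixes r q :: nat
  assumes polycyclic: "polycyclic_realization r q V E p g"
begin

text \<open>Stated through the frontier alone, so that it does not depend on the choice of a
  boundary cycle.\<close>

definition face_edges :: "complex set \<Rightarrow> 'a set set" where
  "face_edges F = {e \<in> E. path_image (g e) \<subseteq> frontier F}"

text \<open>Distinct edges meet only in images of common vertices, so one frontier point on an arc,
  other than its ends, already puts the edge on the boundary cycle.\<close>

lemma interior_face_cycle:
  assumes "F \<in> interior_faces V E p g"
  obtains xs where "is_cycle E xs" "length xs = r"
    "frontier F = (\<Union>e\<in>cycle_edges xs. path_image (g e))"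
    "\<And>e x. e \<in> E \<Longrightarrow> x \<in> path_image (g e) - p ` e \<Longrightarrow> x \<in> frontier F \<Longrightarrow> e \<in> cycle_edges xs"
    "face_edges F = cycle_edges xs" "face_vertices V p F = set xs"
proof -
  obtain xs where xs: "is_cycle E xs" "length xs = r"
    "frontier F = (\<Union>e\<in>cycle_edges xs. path_image (g e))"
    using polycyclic assms by (auto simp: polycyclic_realization_def combinatorial_gon_def)
  have sub: "cycle_edges xs \<subseteq> E" using xs by (simp add: is_cycle_def)
  have *: "e \<in> cycle_edges xs"
    if e: "e \<in> E" "x \<in> path_image (g e) - p ` e" "x \<in> frontier F" for e x
  proof -
    obtain f where f: "f \<in> cycle_edges xs" "x \<in> path_image (g f)" using e xs by blast
    then have "e = f" using edge_Int_edge[of e f] e sub by blast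
    then show ?thesis using f by simp
  qed
  have "face_edges F = cycle_edges xs"
  proof
    show "cycle_edges xs \<subseteq> face_edges F" using xs sub by (auto simp: face_edges_def)
    show "face_edges F \<subseteq> cycle_edges xs"
      using * endless_edge(2) unfolding face_edges_def by blast
  qed
  moreover have "face_vertices V p F = set xs"
  proof -
    have "face_vertices V p F = {v \<in> V. \<exists>e\<in>cycle_edges xs. v \<in> e}"
      unfolding face_vertices_def xs(3) using sub vertex_on_edge_iff by blast
    also have "\<dots> = \<Union> (cycle_edges xs)" using sub edge_subset by blast
    finally show ?thesis using Union_cycle_edges[OF xs(1)] by simp
  qed
  ultimately show thesis using that xs * by blast
qed

lemma edge_in_face:
  assumes "F \<in> interior_faces V E p g" "e \<in> E" "x \<in> path_image (g e) - p ` e" "x \<in> frontier F"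
  shows "e \<in> face_edges F"
  by (rule interior_face_cycle[OF assms(1)]) (use assms(2-) in blast)

lemma card_face_vertices: "F \<in> interior_faces V E p g \<Longrightarrow> card (face_vertices V p F) = r"
  by (erule interior_face_cycle) (simp add: is_cycle_def distinct_card)

lemma card_face_edges_at:
  "F \<in> interior_faces V E p g \<Longrightarrow> v \<in> face_vertices V p F \<Longrightarrow> card {e \<in> face_edges F. v \<in> e} = 2"
  by (erule interior_face_cycle) (simp add: card_cycle_edges_at)

lemma frontier_eq_face_edges:
  "F \<in> interior_faces V E p g \<Longrightarrow> frontier F = (\<Union>e\<in>face_edges F. path_image (g e))"
  by (erule interior_face_cycle) simp

lemma interior_face_curve:
  assumes "F \<in> interior_faces V E p g"
  obtains h where "simple_path h" "pathfinish h = pathstart h" "path_image h = frontier F"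
    "F = inside (frontier F)"
proof -
  obtain xs where xs: "is_cycle E xs" "frontier F = (\<Union>e\<in>cycle_edges xs. path_image (g e))"
    using interior_face_cycle[OF assms] .
  obtain h where h: "simple_path h" "pathfinish h = pathstart h"
    "path_image h = (\<Union>e\<in>cycle_edges xs. path_image (g e))"
    using cycle_simple_closed_curve[OF xs(1)] .
  then show thesis using that[of h] xs face_eq_inside[OF assms, of h] by simp
qed

text \<open>A face is the inside of its frontier, and the frontier is the union of its edges; so the
  face is determined by a subset of the finite set \<open>E\<close>.\<close>

lemma finite_interior_faces: "finite (interior_faces V E p g)"
proof (rule finite_imageD)
  have "face_edges ` interior_faces V E p g \<subseteq> Pow E" by (auto simp: face_edges_def)
  then show "finite (face_edges ` interior_faces V E p g)"
    using finite_E finite_subset by blast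
  show "inj_on face_edges (interior_faces V E p g)"
    by (rule inj_onI) (metis frontier_eq_face_edges interior_face_curve)
qed

lemma face_edge_vertices:
  "e \<in> face_edges F \<Longrightarrow> v \<in> e \<Longrightarrow> v \<in> face_vertices V p F"
  using ends_subset edge_subset unfolding face_edges_def face_vertices_def by blast

section \<open>Two interior faces sharing an edge\<close>

lemma closure_Int_common_edge:
  assumes F: "F1 \<in> interior_faces V E p g" "F2 \<in> interior_faces V E p g" "F1 \<noteq> F2"
    and e: "e \<in> face_edges F1" "e \<in> face_edges F2"
  shows "closure F1 \<inter> closure F2 = path_image (g e)"
proof -
  have "e \<in> E" using e by (simp add: face_edges_def)
  have sub: "path_image (g e) \<subseteq> closure F1 \<inter> closure F2"
    using e by (auto simp: face_edges_def frontier_def)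
  obtain x where x: "x \<in> path_image (g e) - p ` e" using endless_edge(2)[OF \<open>e \<in> E\<close>] by blast
  consider f where "f \<in> E" "closure F1 \<inter> closure F2 = path_image (g f)"
    | v where "v \<in> V" "closure F1 \<inter> closure F2 = {p v}"
    | "closure F1 \<inter> closure F2 = {}"
    using polycyclic F unfolding polycyclic_realization_def by meson
  then show ?thesis
  proof cases
    case 1
    then have "x \<in> path_image (g e) \<inter> path_image (g f)" using x sub by blast
    then have "e = f" using x edge_Int_edge[of e f] 1 \<open>e \<in> E\<close> by blast
    then show ?thesis using 1 by simp
  next
    case 2
    then have "x \<in> {p v}" using x sub by blast
    then have "p v \<in> path_image (g e)" "p v \<notin> p ` e" using x by auto
    then show ?thesis using vertex_on_edge_iff[OF \<open>e \<in> E\<close> 2(1)] by blast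
  next
    case 3
    then show ?thesis using x sub by blast
  qed
qed

text \<open>The inside of the Jordan curve formed by the rest of the two frontiers serves as
  \<open>W\<close>: it contains the open arc by \<open>theta_middle_arc_inside\<close> and is filled
  by the faces and the arc by \<open>inside_symmetric_difference\<close>.\<close>

lemma open_around_common_edge:
  assumes F: "F1 \<in> interior_faces V E p g" "F2 \<in> interior_faces V E p g" "F1 \<noteq> F2"
    and e: "e \<in> face_edges F1" "e \<in> face_edges F2"
  obtains W where "open W" "path_image (g e) - p ` e \<subseteq> W" "W \<subseteq> F1 \<union> F2 \<union> path_image (g e)"
proof -
  have "e \<in> E" using e by (simp add: face_edges_def)
  have rest: "\<exists>c. arc c \<and> {pathstart c, pathfinish c} = p ` e \<and>
      path_image c \<union> path_image (g e) = frontier F \<and> path_image c \<inter> path_image (g e) = p ` e"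
    if F: "F \<in> interior_faces V E p g" "e \<in> face_edges F" for F
  proof -
    obtain xs where xs: "is_cycle E xs" "frontier F = (\<Union>e\<in>cycle_edges xs. path_image (g e))"
      "face_edges F = cycle_edges xs"
      using interior_face_cycle[OF F(1)] .
    have e': "e \<in> cycle_edges xs" using F xs by simp
    obtain c where "arc c" "{pathstart c, pathfinish c} = p ` e"
      "path_image c = (\<Union>f\<in>cycle_edges xs - {e}. path_image (g f))"
      "path_image c \<inter> path_image (g e) = p ` e"
      using cycle_minus_edge_arc[OF xs(1) e'] .
    then show ?thesis using xs(2) e' by (intro exI[of _ c]) auto
  qed
  obtain c1 where c1: "arc c1" "{pathstart c1, pathfinish c1} = p ` e"
    "path_image c1 \<union> path_image (g e) = frontier F1" "path_image c1 \<inter> path_image (g e) = p ` e"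
    using rest[OF F(1) e(1)] by blast
  obtain c2 where c2: "arc c2" "{pathstart c2, pathfinish c2} = p ` e"
    "path_image c2 \<union> path_image (g e) = frontier F2" "path_image c2 \<inter> path_image (g e) = p ` e"
    using rest[OF F(2) e(2)] by blast
  \<comment> \<open>By the cell-complex condition the frontiers share only the arc of
    \<open>e\<close>, so \<open>c1\<close> and \<open>c2\<close> meet only in its ends and close up
    to a Jordan curve.\<close>
  have "frontier F1 \<inter> frontier F2 \<subseteq> path_image (g e)"
    using closure_Int_common_edge[OF assms] by (auto simp: frontier_def)
  then have C12: "frontier F1 \<inter> frontier F2 = path_image (g e)"
    using c1(3) c2(3) by blast
  have "path_image c1 \<inter> path_image c2 \<subseteq> path_image c1 \<inter> path_image (g e)"
    using c1(3) c2(3) C12 by blast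
  then have "path_image c1 \<inter> path_image c2 \<subseteq> p ` e" using c1(4) by simp
  then obtain h where h: "simple_path h" "pathfinish h = pathstart h"
    "path_image h = path_image c1 \<union> path_image c2"
    using arcs_common_ends_loop[of c1 c2] c1(1,2) c2(1,2) by metis
  define C where "C = path_image h"
  have Ce: "path_image (g e) - C = path_image (g e) - p ` e"
    using c1(4) c2(4) h(3) unfolding C_def by blast
  have C: "C \<subseteq> frontier F1 \<union> frontier F2" "frontier F1 \<union> frontier F2 \<subseteq> C \<union> (frontier F1 \<inter> frontier F2)"
    unfolding C_def h(3) C12 using c1(3) c2(3) by blast+
  have inF: "inside (frontier F1) = F1" "inside (frontier F2) = F2"
    using F interior_face_curve by metis+
  have compact: "compact (frontier F1)" "compact (frontier F2)"
    using F by (simp_all add: interior_faces_def compact_frontier_bounded)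
  have conn: "connected F1" "connected F2"
    using F in_components_connected by (auto simp: interior_faces_def faces_def)
  have "inside C \<noteq> {}" "open (inside C)"
    using Jordan_inside_outside[OF h(1,2)] by (auto simp: C_def)
  have "closed C" unfolding C_def using h(1) by (simp add: closed_path_image simple_path_imp_path)
  have "F1 \<inter> F2 = {}" using F faces_disjoint interior_faceD by blast
  show thesis
  proof (rule that)
    show "path_image (g e) - p ` e \<subseteq> inside C"
      using theta_middle_arc_inside[of "frontier F1" "frontier F2" C] C compact conn inF C12 Ce
        endless_edge[OF \<open>e \<in> E\<close>] \<open>closed C\<close> \<open>inside C \<noteq> {}\<close> \<open>F1 \<inter> F2 = {}\<close>
        connected_arc_image[OF arc_edge[OF \<open>e \<in> E\<close>]] by simp
    show "inside C \<subseteq> F1 \<union> F2 \<union> path_image (g e)"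
      using inside_symmetric_difference[of "frontier F1" "frontier F2" C] C compact inF C12
        connected_arc_image[OF arc_edge[OF \<open>e \<in> E\<close>]] by simp
  qed fact
qed

text \<open>\<open>F\<close> may also be the exterior face. Thus the lemma both limits the faces at
  an edge to two and keeps the open arc away from the exterior.\<close>

lemma common_edge_notin_closure:
  assumes F: "F1 \<in> interior_faces V E p g" "F2 \<in> interior_faces V E p g" "F1 \<noteq> F2"
    and e: "e \<in> face_edges F1" "e \<in> face_edges F2"
    and F': "F \<in> faces V E p g" "F \<noteq> F1" "F \<noteq> F2"
    and x: "x \<in> path_image (g e) - p ` e"
  shows "x \<notin> closure F"
proof -
  obtain W where W: "open W" "path_image (g e) - p ` e \<subseteq> W" "W \<subseteq> F1 \<union> F2 \<union> path_image (g e)"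
    using open_around_common_edge[OF F e] .
  have "F \<inter> F1 = {}" "F \<inter> F2 = {}" using F F' faces_disjoint interior_faceD by blast+
  moreover have "F \<inter> path_image (g e) = {}"
    using face_Int_skeleton[OF F'(1)] edge_subset_skeleton e by (auto simp: face_edges_def)
  ultimately have "W \<inter> F = {}" using W by blast
  then show ?thesis using W x open_Int_closure_eq_empty[of W F] by blast
qed

section \<open>Faces around an interior vertex\<close>

lemma closure_faces:
  "closure (outside S) \<union> (\<Union>F\<in>interior_faces V E p g. closure F) = UNIV"
proof -
  let ?K = "closure (outside S) \<union> (\<Union>F\<in>interior_faces V E p g. closure F)"
  have "- S \<subseteq> ?K"
    using Union_interior_faces inside_Un_outside[of S] closure_subset by blast
  moreover have "closed ?K" using finite_interior_faces by (intro closed_Un closed_UN) auto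
  ultimately have "closure (- S) \<subseteq> ?K" by (rule closure_minimal)
  then show ?thesis using interior_skeleton by (simp add: closure_complement top.extremum_unique)
qed

text \<open>The vertex is a limit point of its edge, so infinitely many points of the edge lie in
  the open complement of \<open>closure (outside S)\<close>, and only finitely many of them are
  ends.\<close>

lemma interior_vertex_edge_point:
  assumes v: "v \<in> interior_vertices V E p g" and e: "e \<in> E" "v \<in> e"
  obtains x where "x \<in> path_image (g e) - p ` e" "x \<notin> closure (outside S)"
proof -
  have "p v islimpt path_image (g e)"
  proof (rule connected_imp_perfect)
    show "connected (path_image (g e))" using arc_edge[OF e(1)] by (rule connected_arc_image)
    show "p v \<in> path_image (g e)" using e ends_subset by blast
    show "path_image (g e) \<noteq> {x}" for x
    proof
      assume eq: "path_image (g e) = {x}"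
      then have "p v = x" using ends_subset[OF e(1)] e(2) by blast
      then show False using endless_edge(2)[OF e(1)] e(2) eq by blast
    qed
  qed
  moreover have "open (- closure (outside S))" "p v \<in> - closure (outside S)"
    using v interior_vertex_iff by auto
  ultimately have "infinite (- closure (outside S) \<inter> path_image (g e))"
    unfolding islimpt_eq_acc_point by blast
  moreover have "finite (p ` e)" using finite_edge e by blast
  ultimately have "\<not> - closure (outside S) \<inter> path_image (g e) \<subseteq> p ` e"
    using finite_subset by blast
  then show thesis using that by blast
qed

lemma two_faces_at_edge:
  assumes v: "v \<in> interior_vertices V E p g" and e: "e \<in> E" "v \<in> e"
  obtains F1 F2 where "F1 \<in> interior_faces V E p g" "F2 \<in> interior_faces V E p g" "F1 \<noteq> F2"
    "e \<in> face_edges F1" "e \<in> face_edges F2"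
proof -
  let ?I = "interior_faces V E p g"
  obtain x where x: "x \<in> path_image (g e) - p ` e" "x \<notin> closure (outside S)"
    using interior_vertex_edge_point[OF assms] .
  have "x \<in> S" using x e edge_subset_skeleton by blast
  have edge: "e \<in> face_edges F" if "F \<in> ?I" "x \<in> closure F" for F
  proof -
    have "x \<notin> F" using that \<open>x \<in> S\<close> face_Int_skeleton interior_faceD by blast
    then have "x \<in> frontier F" using that interior_subset by (auto simp: frontier_def)
    then show ?thesis using edge_in_face that e x by blast
  qed
  obtain F1 where F1: "F1 \<in> ?I" "x \<in> closure F1" using closure_faces x by blast
  have "\<exists>F2\<in>?I. F2 \<noteq> F1 \<and> x \<in> closure F2"
  proof (rule ccontr)
    assume none: "\<not> ?thesis"
    \<comment> \<open>\<open>K\<close> collects the closed pieces of the plane other than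
      \<open>closure F1\<close> and the arc of \<open>e\<close>; its complement is an open
      neighbourhood of \<open>x\<close>.\<close>
    define K where "K = closure (outside S) \<union> (\<Union>F\<in>?I - {F1}. closure F) \<union>
      (\<Union>f\<in>E - {e}. path_image (g f)) \<union> p ` V"
    have "closed K"
      unfolding K_def using finite_interior_faces finite_E finite_V closed_edge
      by (intro closed_Un closed_UN) (auto simp: finite_imp_closed)
    have "x \<notin> path_image (g f)" if "f \<in> E - {e}" for f
      using x edge_Int_edge[OF e(1), of f] that by blast
    moreover have "x \<notin> p ` V" using x edge_Int_vertices[OF e(1)] by blast
    ultimately have "x \<notin> K" using none x(2) by (auto simp: K_def)
    obtain h where h: "simple_path h" "pathfinish h = pathstart h" "path_image h = frontier F1"
      "F1 = inside (frontier F1)"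
      using interior_face_curve[OF F1(1)] .
    \<comment> \<open>Every point of a Jordan curve lies in the closure of its outside. A nearby
      outside point \<open>y\<close> avoids \<open>K\<close>, \<open>F1\<close> and the arc of
      \<open>e\<close>, which leaves no face for it.\<close>
    then have "x \<in> closure (outside (frontier F1))"
      using Jordan_inside_outside[OF h(1,2)] edge[OF F1] x
      by (auto simp: face_edges_def frontier_def)
    then obtain y where y: "y \<notin> K" "y \<in> outside (frontier F1)"
      using \<open>closed K\<close> \<open>x \<notin> K\<close> open_Int_closure_eq_empty[of "- K" "outside (frontier F1)"] by blast
    have "y \<notin> F1" using y h(4) inside_Int_outside by blast
    moreover have "y \<notin> path_image (g e)"
      using y outside_no_overlap[of "frontier F1"] edge[OF F1] unfolding face_edges_def by blast
    then have "y \<notin> S" using y by (auto simp: skeleton_def K_def)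
    then have "y \<in> outside S \<union> \<Union> ?I"
      using Union_interior_faces inside_Un_outside by blast
    then have "y \<in> F1" using y closure_subset unfolding K_def by blast
    ultimately show False by blast
  qed
  then show thesis using that F1 edge by metis
qed

lemma card_faces_at_edge:
  assumes "v \<in> interior_vertices V E p g" "e \<in> E" "v \<in> e"
  shows "card {F \<in> interior_faces V E p g. e \<in> face_edges F} = 2"
proof -
  obtain F1 F2 where F: "F1 \<in> interior_faces V E p g" "F2 \<in> interior_faces V E p g" "F1 \<noteq> F2"
    "e \<in> face_edges F1" "e \<in> face_edges F2"
    using two_faces_at_edge[OF assms] .
  obtain x where x: "x \<in> path_image (g e) - p ` e" using endless_edge(2)[OF assms(2)] by blast
  have "F = F1 \<or> F = F2" if "F \<in> interior_faces V E p g" "e \<in> face_edges F" for F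
  proof -
    have "x \<in> closure F" using that x by (auto simp: face_edges_def frontier_def)
    then show ?thesis using common_edge_notin_closure[OF F _ _ _ x] that interior_faceD by blast
  qed
  then have "{F \<in> interior_faces V E p g. e \<in> face_edges F} = {F1, F2}" using F by blast
  then show ?thesis using F(3) by simp
qed

text \<open>Incidences of edges at \<open>v\<close> with interior faces are counted in two ways:
  each such edge lies on two faces, and each face at \<open>v\<close> has two edges there. So the
  number of faces at \<open>v\<close> is its degree.\<close>

lemma card_faces_at_vertex:
  assumes "v \<in> interior_vertices V E p g"
  shows "card {F \<in> interior_faces V E p g. v \<in> face_vertices V p F} = q"
proof -
  let ?I = "interior_faces V E p g" and ?D = "{e \<in> E. v \<in> e}"
  let ?N = "{F \<in> ?I. v \<in> face_vertices V p F}"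
  have at: "{e \<in> ?D. e \<in> face_edges F} = {e \<in> face_edges F. v \<in> e}" for F
    by (auto simp: face_edges_def)
  have "2 * card ?D = (\<Sum>F\<in>?I. card {e \<in> ?D. e \<in> face_edges F})"
    by (subst sum_multicount[where k = 2])
      (use finite_interior_faces finite_E card_faces_at_edge[OF assms] in auto)
  also have "\<dots> = (\<Sum>F\<in>?N. card {e \<in> ?D. e \<in> face_edges F})"
  proof (rule sum.mono_neutral_right)
    show "\<forall>F\<in>?I - ?N. card {e \<in> ?D. e \<in> face_edges F} = 0"
    proof
      fix F assume "F \<in> ?I - ?N"
      then have "{e \<in> ?D. e \<in> face_edges F} = {}" using face_edge_vertices by blast
      then show "card {e \<in> ?D. e \<in> face_edges F} = 0" by (simp only: card.empty)
    qed
  qed (use finite_interior_faces in auto)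
  also have "\<dots> = (\<Sum>F\<in>?N. 2)"
    by (rule sum.cong[OF refl]) (simp only: at, simp add: card_face_edges_at)
  finally have "card ?D = card ?N" by simp
  moreover have "card ?D = q"
    using polycyclic assms by (auto simp: polycyclic_realization_def vertex_degree_def)
  ultimately show ?thesis by simp
qed

section \<open>Counting incidences of interior vertices and faces\<close>

lemma sum_interior_vertices_of_faces:
  "(\<Sum>F\<in>interior_faces V E p g. card (face_vertices V p F \<inter> interior_vertices V E p g))
    = q * card (interior_vertices V E p g)"
proof -
  have fin: "finite (interior_vertices V E p g)"
    using finite_V by (simp add: interior_vertices_def)
  have "face_vertices V p F \<inter> interior_vertices V E p g
      = {v \<in> interior_vertices V E p g. v \<in> face_vertices V p F}" for F
    by blast
  then show ?thesis
    using sum_multicount[OF finite_interior_faces fin, of "\<lambda>F v. v \<in> face_vertices V p F" q]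
      card_faces_at_vertex by simp
qed

text \<open>Otherwise connectedness of the plane gives a point \<open>x\<close> common to the
  closures of the exterior face and of an interior face. It lies on an edge; it is no end, since the
  ends are interior vertices, and no other point, since two interior faces shield the open
  arc.\<close>

lemma boundary_vertex_exists:
  assumes "interior_faces V E p g \<noteq> {}"
  shows "\<exists>F\<in>interior_faces V E p g. \<not> face_vertices V p F \<subseteq> interior_vertices V E p g"
proof (rule ccontr)
  let ?I = "interior_faces V E p g"
  let ?U = "\<Union>F\<in>?I. closure F"
  assume "\<not> ?thesis"
  then have all: "face_vertices V p F \<subseteq> interior_vertices V E p g" if "F \<in> ?I" for F
    using that by blast
  have "closed ?U" using finite_interior_faces by (intro closed_UN) auto
  moreover have "closure (outside S) \<noteq> {}" using outside_face(2) by auto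
  moreover obtain F0 where "F0 \<in> ?I" using assms by blast
  then have "?U \<noteq> {}"
    using in_components_nonempty by (fastforce simp: interior_faces_def faces_def)
  ultimately have "closure (outside S) \<inter> ?U \<noteq> {}"
    using connected_UNIV[where 'a = complex] closure_faces closed_closure
    unfolding connected_closed by (metis Int_UNIV_right Int_empty_left top.extremum inf_top_left)
  then obtain x F where F: "F \<in> ?I" "x \<in> closure F" and x: "x \<in> closure (outside S)" by blast
  have "x \<notin> F"
    using x open_Int_closure_eq_empty[OF open_face[OF interior_faceD[OF F(1)]]]
      interior_face_Int_outside[OF F(1)] by blast
  then have "x \<in> frontier F" using F interior_subset by (auto simp: frontier_def)
  then obtain e where e: "e \<in> face_edges F" "x \<in> path_image (g e)"
    using frontier_eq_face_edges F by blast
  then have "e \<in> E" by (simp add: face_edges_def)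
  have int: "v \<in> interior_vertices V E p g" if "v \<in> e" for v
    using that all[OF F(1)] e face_edge_vertices by blast
  have "e \<noteq> {}" using simple \<open>e \<in> E\<close> by (auto simp: simple_graph_def)
  then obtain v where v: "v \<in> e" by blast
  obtain F1 F2 where F12: "F1 \<in> ?I" "F2 \<in> ?I" "F1 \<noteq> F2" "e \<in> face_edges F1" "e \<in> face_edges F2"
    using two_faces_at_edge[OF int[OF v] \<open>e \<in> E\<close> v] .
  have "outside S \<noteq> F1" "outside S \<noteq> F2" using F12 outside_face(2) by (auto simp: interior_faces_def)
  moreover have "x \<notin> p ` e" using int x interior_vertex_iff by blast
  ultimately show False using common_edge_notin_closure[OF F12 outside_face(1)] e x by blast
qed

text \<open>The inside of the Jordan curve of a cycle has a point off the nowhere dense skeleton,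
  and this point is not exterior because \<open>outside S\<close> lies outside the curve.\<close>

lemma interior_faces_nonempty:
  assumes "is_cycle E xs"
  shows "interior_faces V E p g \<noteq> {}"
proof -
  obtain h where h: "simple_path h" "pathfinish h = pathstart h"
    "path_image h = (\<Union>e\<in>cycle_edges xs. path_image (g e))"
    using cycle_simple_closed_curve[OF assms] .
  have "path_image h \<subseteq> S"
    using h(3) assms edge_subset_skeleton by (auto simp: is_cycle_def)
  have "open (inside (path_image h))" "inside (path_image h) \<noteq> {}"
    using Jordan_inside_outside[OF h(1,2)] by auto
  then have "\<not> inside (path_image h) \<subseteq> S"
    using interior_skeleton interior_maximal by blast
  then obtain y where "y \<in> inside (path_image h)" "y \<notin> S" by blast
  moreover have "outside S \<subseteq> outside (path_image h)"
    using \<open>path_image h \<subseteq> S\<close> by (rule outside_mono)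
  ultimately have "y \<in> inside S"
    using inside_Int_outside[of "path_image h"] inside_Un_outside[of S] by blast
  then show ?thesis using Union_interior_faces by blast
qed

text \<open>Each face contributes between \<open>1\<close> and \<open>r\<close> incidences; a face
  with a boundary vertex contributes fewer than \<open>r\<close>, which makes the upper bound
  strict.\<close>

lemma incidence_bounds:
  assumes "\<forall>F\<in>interior_faces V E p g. face_vertices V p F \<inter> interior_vertices V E p g \<noteq> {}"
    and "interior_faces V E p g \<noteq> {}"
  shows "card (interior_faces V E p g) \<le> q * card (interior_vertices V E p g)"
    "q * card (interior_vertices V E p g) < r * card (interior_faces V E p g)"
proof -
  let ?I = "interior_faces V E p g" and ?f = "\<lambda>F. card (face_vertices V p F \<inter> interior_vertices V E p g)"
  have fin: "finite (face_vertices V p F)" for F using finite_V by (simp add: face_vertices_def)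
  have "(\<Sum>F\<in>?I. 1) \<le> (\<Sum>F\<in>?I. ?f F)"
    by (rule sum_mono) (use assms(1) fin in \<open>simp add: Suc_le_eq card_gt_0_iff\<close>)
  then show "card ?I \<le> q * card (interior_vertices V E p g)"
    by (simp add: sum_interior_vertices_of_faces)
  have le: "?f F \<le> r" if "F \<in> ?I" for F
    using card_mono[OF fin, of "face_vertices V p F \<inter> interior_vertices V E p g" F]
      card_face_vertices[OF that] by simp
  obtain F where F: "F \<in> ?I" "\<not> face_vertices V p F \<subseteq> interior_vertices V E p g"
    using boundary_vertex_exists[OF assms(2)] by blast
  then have "?f F < r"
    using psubset_card_mono[OF fin, of "face_vertices V p F \<inter> interior_vertices V E p g" F]
      card_face_vertices by auto
  then have "(\<Sum>F\<in>?I. ?f F) < (\<Sum>F\<in>?I. r)"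
    using F le finite_interior_faces by (intro sum_strict_mono_ex1) auto
  then show "q * card (interior_vertices V E p g) < r * card ?I"
    by (simp add: sum_interior_vertices_of_faces mult.commute)
qed

end

theorem theorem9:
  fixes r q :: nat
    and V :: "'a set" and E :: "'a set set"
    and p :: "'a \<Rightarrow> complex" and g :: "'a set \<Rightarrow> real \<Rightarrow> complex"
  assumes "finite_polycycle r q V E"
    and "polycyclic_realization r q V E p g"
    and "\<forall>F \<in> interior_faces V E p g. face_vertices V p F \<inter> interior_vertices V E p g \<noteq> {}"
  shows "real (num_interior_faces V E p g) / real q \<le> real (num_interior_vertices V E p g) \<and>
         real (num_interior_vertices V E p g) < real r * real (num_interior_faces V E p g) / real q"
proof -
  interpret polycyclic V E p g r q
    using assms(1,2) by unfold_locales (auto simp: finite_polycycle_def polycyclic_realization_def)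
  \<comment> \<open>The infimum over an empty set of cycles is infinite, whereas the girth is the
    natural number \<open>r\<close>.\<close>
  have "{xs. is_cycle E xs} \<noteq> {}"
  proof
    assume "{xs. is_cycle E xs} = {}"
    then have "girth E = \<infinity>" by (simp add: girth_def top_enat_def)
    then show False using assms(1) by (simp add: finite_polycycle_def)
  qed
  then obtain xs where xs: "is_cycle E xs" by blast
  \<comment> \<open>Needed to clear the denominators: a vertex on a cycle has degree at least two
    and at most \<open>q\<close>.\<close>
  have "q > 0"
  proof -
    have "xs \<noteq> []" "cycle_edges xs \<subseteq> E" using xs by (auto simp: is_cycle_def)
    then have v: "hd xs \<in> set xs" by simp
    have "hd xs \<in> V"
      using v Union_cycle_edges[OF xs] \<open>cycle_edges xs \<subseteq> E\<close> edge_subset by blast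
    have "2 \<le> vertex_degree E (hd xs)"
      unfolding vertex_degree_def card_cycle_edges_at[OF xs v, symmetric]
      using \<open>cycle_edges xs \<subseteq> E\<close> finite_E by (intro card_mono) auto
    also have "\<dots> \<le> q" using assms(1) \<open>hd xs \<in> V\<close> by (simp add: finite_polycycle_def)
    finally show ?thesis by simp
  qed
  then show ?thesis
    using incidence_bounds[OF assms(3) interior_faces_nonempty[OF xs]]
    unfolding num_interior_faces_def num_interior_vertices_def
    by (simp add: field_simps flip: of_nat_mult)
qed

end
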